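(* Let $A, B \subseteq \mathbb{N}$ be computable sets such that $B$ is not negligible and the complement $\mathbb{N}\setminus B$ is not negligible (i.e., $B$ does not have asymptotic density $0$ or $1$). Then $A \leq_{gm} B$. In particular, any two computable sets $A, B\subseteq\mathbb{N}$ each of which is not negligible and has non-negligible complement satisfy both $A \leq_{gm} B$ and $B \leq_{gm} A$.
   Context: For $A\subseteq \mathbb{N}$ and $n\ge 1$, $\rho_n(A) = \#\{k<n \mid k\in A\}/n$. The asymptotic density $\rho(A)$ is $\lim_n \rho_n(A)$ when this limit exists. A set $A$ is negligible if $\rho(A)=0$ (i.e., $\rho_n(A)\to 0$). A total function $f\colon\mathbb{N}\to\mathbb{N}$ is uniform if $f^{-1}(S)$ is negligible for every negligible $S\subseteq\mathbb{N}$. We write $A\leq_{gm} B$ ($A$ is generically m-reducible to $B$) if there is a uniform total computable function $f\colon\mathbb{N}\to\mathbb{N}$ such that for all $x\in\mathbb{N}$, $x\in A \iff f(x)\in B$. *)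

theory Defs
  imports Complex_Main
begin

text \<open>
  Computability is defined through the partial recursive functions: terms built from the basic
  functions by composition, primitive recursion and unbounded minimization, with a big-step
  evaluation relation on argument lists.  Arities are not tracked: \<open>Zero\<close> accepts any argument
  list, \<open>Succ\<close> ignores surplus arguments.  Primitive recursion and minimization act on the first
  argument; the step function of \<open>PrimRec\<close> receives the counter, the previous value and the
  parameters, in this order.
\<close>

datatype recf =
    Zero
  | Succ
  | Proj nat
  | Comp recf "recf list"
  | PrimRec recf recf
  | Mu recf

inductive rec_eval :: "recf \<Rightarrow> nat list \<Rightarrow> nat \<Rightarrow> bool" where
  Zero: "rec_eval Zero xs 0"
| Succ: "rec_eval Succ (x # xs) (Suc x)"
| Proj: "i < length xs \<Longrightarrow> rec_eval (Proj i) xs (xs ! i)"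
| Comp: "list_all2 (\<lambda>g y. rec_eval g xs y) gs ys \<Longrightarrow> rec_eval f ys z
          \<Longrightarrow> rec_eval (Comp f gs) xs z"
| PrimRec_0: "rec_eval f xs y \<Longrightarrow> rec_eval (PrimRec f g) (0 # xs) y"
| PrimRec_Suc: "rec_eval (PrimRec f g) (n # xs) y \<Longrightarrow> rec_eval g (n # y # xs) z
          \<Longrightarrow> rec_eval (PrimRec f g) (Suc n # xs) z"
| Mu: "rec_eval f (n # xs) 0 \<Longrightarrow> (\<forall>m<n. \<exists>y. rec_eval f (m # xs) (Suc y))
          \<Longrightarrow> rec_eval (Mu f) xs n"

inductive_cases rec_eval_ZeroE: "rec_eval Zero xs y"
inductive_cases rec_eval_SuccE: "rec_eval Succ xs y"
inductive_cases rec_eval_ProjE: "rec_eval (Proj i) xs y"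
inductive_cases rec_eval_CompE: "rec_eval (Comp f gs) xs y"
inductive_cases rec_eval_PrimRec_0E: "rec_eval (PrimRec f g) (0 # xs) y"
inductive_cases rec_eval_PrimRec_SucE: "rec_eval (PrimRec f g) (Suc n # xs) y"
inductive_cases rec_eval_MuE: "rec_eval (Mu f) xs y"

lemma rec_eval_deterministic:
  "rec_eval r xs y \<Longrightarrow> rec_eval r xs z \<Longrightarrow> y = z"
proof (induction r xs y arbitrary: z rule: rec_eval.induct)
  case (Zero xs)
  then show ?case by (auto elim: rec_eval_ZeroE)
next
  case (Succ x xs)
  then show ?case by (auto elim: rec_eval_SuccE)
next
  case (Proj i xs)
  then show ?case by (auto elim: rec_eval_ProjE)
next
  case (Comp xs gs ys f w)
  from Comp.prems obtain ys' where ys': "list_all2 (\<lambda>g y. rec_eval g xs y) gs ys'" "rec_eval f ys' z"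
    by (rule rec_eval_CompE)
  have "ys = ys'"
  proof (rule nth_equalityI)
    show len: "length ys = length ys'"
      using list_all2_lengthD [OF Comp.IH(1)] list_all2_lengthD [OF ys'(1)] by simp
    fix i assume i: "i < length ys"
    show "ys ! i = ys' ! i"
      using list_all2_nthD2 [OF Comp.IH(1) i] list_all2_nthD2 [OF ys'(1)] i len by simp
  qed
  with ys'(2) show ?case by (intro Comp.IH(2)) simp
next
  case (PrimRec_0 f xs y g)
  from PrimRec_0.prems show ?case
    by (rule rec_eval_PrimRec_0E) (rule PrimRec_0.IH)
next
  case (PrimRec_Suc f g n xs y w)
  from PrimRec_Suc.prems show ?case
    by (rule rec_eval_PrimRec_SucE) (use PrimRec_Suc.IH in simp)
next
  case (Mu f n xs)
  from Mu.prems obtain z: "rec_eval f (z # xs) 0" "\<forall>m<z. \<exists>y. rec_eval f (m # xs) (Suc y)"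
    by (rule rec_eval_MuE)
  have "\<not> z < n" using Mu.IH(2) z(1) by blast
  moreover have "\<not> n < z" using Mu.IH(1) z(2) by blast
  ultimately show ?case by simp
qed

definition computable_fun :: "(nat \<Rightarrow> nat) \<Rightarrow> bool" where
  "computable_fun f \<longleftrightarrow> (\<exists>r. \<forall>x. rec_eval r [x] (f x))"

definition computable_set :: "nat set \<Rightarrow> bool" where
  "computable_set A \<longleftrightarrow> computable_fun (\<lambda>x. if x \<in> A then 1 else 0)"

definition rho :: "nat \<Rightarrow> nat set \<Rightarrow> real" where
  "rho n A = real (card {k. k < n \<and> k \<in> A}) / real n"

definition has_density :: "nat set \<Rightarrow> real \<Rightarrow> bool" where
  "has_density A d \<longleftrightarrow> (\<lambda>n. rho n A) \<longlonglongrightarrow> d"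

definition negligible_set :: "nat set \<Rightarrow> bool" where
  "negligible_set A \<longleftrightarrow> has_density A 0"

lemma rho_Compl: "n \<ge> 1 \<Longrightarrow> rho n (- A) = 1 - rho n A"
proof -
  assume n: "n \<ge> 1"
  have "{k. k < n \<and> k \<in> A} \<union> {k. k < n \<and> k \<in> - A} = {..<n}" by auto
  moreover have "card ({k. k < n \<and> k \<in> A} \<union> {k. k < n \<and> k \<in> - A}) =
      card {k. k < n \<and> k \<in> A} + card {k. k < n \<and> k \<in> - A}"
    by (rule card_Un_disjoint) auto
  ultimately have "card {k. k < n \<and> k \<in> A} + card {k. k < n \<and> k \<in> - A} = n"
    by (simp only: card_lessThan)
  then have "real (card {k. k < n \<and> k \<in> A}) + real (card {k. k < n \<and> k \<in> - A}) = real n"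
    by (simp only: of_nat_add [symmetric])
  then have "real (card {k. k < n \<and> k \<in> - A}) = real n - real (card {k. k < n \<and> k \<in> A})"
    by (simp only: eq_diff_eq add.commute)
  then show ?thesis using n unfolding rho_def by (simp only: diff_divide_distrib) simp
qed

lemma negligible_set_Compl_iff: "negligible_set (- A) \<longleftrightarrow> has_density A 1"
proof -
  have ev: "eventually (\<lambda>n. rho n (- A) = 1 - rho n A) sequentially"
    using eventually_ge_at_top [of 1] by (rule eventually_mono) (rule rho_Compl)
  have "(\<lambda>n. rho n (- A)) \<longlonglongrightarrow> 0 \<longleftrightarrow> (\<lambda>n. 1 - rho n A) \<longlonglongrightarrow> 0"
    using ev by (rule tendsto_cong)
  also have "\<dots> \<longleftrightarrow> (\<lambda>n. rho n A) \<longlonglongrightarrow> 1"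
  proof
    assume "(\<lambda>n. 1 - rho n A) \<longlonglongrightarrow> 0"
    from tendsto_diff [OF tendsto_const [of 1] this] show "(\<lambda>n. rho n A) \<longlonglongrightarrow> 1" by simp
  next
    assume "(\<lambda>n. rho n A) \<longlonglongrightarrow> 1"
    from tendsto_diff [OF tendsto_const [of 1] this] show "(\<lambda>n. 1 - rho n A) \<longlonglongrightarrow> 0" by simp
  qed
  finally show ?thesis by (simp add: negligible_set_def has_density_def)
qed

definition uniform_fun :: "(nat \<Rightarrow> nat) \<Rightarrow> bool" where
  "uniform_fun f \<longleftrightarrow> (\<forall>S. negligible_set S \<longrightarrow> negligible_set (f -` S))"

definition gm_reducible :: "nat set \<Rightarrow> nat set \<Rightarrow> bool" (infix \<open>\<le>\<^sub>g\<^sub>m\<close> 50) where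
  "A \<le>\<^sub>g\<^sub>m B \<longleftrightarrow> (\<exists>f. uniform_fun f \<and> computable_fun f \<and> (\<forall>x. x \<in> A \<longleftrightarrow> f x \<in> B))"

end

theory Submission imports Defs "HOL-Library.Infinite_Set" begin

text \<open>
  It suffices to find, for every non-negligible computable \<open>B\<close>, a uniform computable \<open>g\<close> with
  values in \<open>B\<close>: then \<open>f x\<close> uses such a function for \<open>B\<close> or for the complement of \<open>B\<close>,
  depending on whether \<open>x \<in> A\<close>.

  Let \<open>b\<close> enumerate \<open>B\<close> increasingly.  Since \<open>B\<close> is not negligible, there is a constant \<open>q\<close> such
  that \<open>b e \<le> q e\<close> for infinitely many \<open>e\<close>; call these \<open>e\<close> good.  Let \<open>g\<close> list
  \<open>b 0, b 1, b 2, \<dots>\<close> and start again from \<open>b 0\<close> as soon as the current index reaches the largest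
  good number not exceeding the current time.  A run that stops at the good number \<open>e\<close> takes
  \<open>e + 1\<close> steps, and it meets a negligible set \<open>S\<close> at most as often as \<open>S\<close> has elements up to
  \<open>q e\<close>, which is \<open>o(e)\<close>.  The run in progress stays below a good number not exceeding the time,
  so it contributes a negligible amount as well.
\<close>

subsection \<open>Closure properties of the recursive functions\<close>

text \<open>Terms carry no arity, so the length \<open>k\<close> of the argument lists is fixed
  here; on other lengths \<open>F\<close> is arbitrary.\<close>

definition recursive :: "nat \<Rightarrow> (nat list \<Rightarrow> nat) \<Rightarrow> bool" where
  "recursive k F \<longleftrightarrow> (\<exists>r. \<forall>xs. length xs = k \<longrightarrow> rec_eval r xs (F xs))"

lemma recursive_cong:
  assumes "recursive k F" and "\<And>xs. length xs = k \<Longrightarrow> F xs = G xs"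
  shows "recursive k G"
  using assms unfolding recursive_def by metis

lemma recursive_proj: "i < k \<Longrightarrow> recursive k (\<lambda>xs. xs ! i)"
  unfolding recursive_def by (metis rec_eval.Proj)

lemma recursive_compose:
  assumes "recursive (length Fs) G" and "\<And>F. F \<in> set Fs \<Longrightarrow> recursive k F"
  shows "recursive k (\<lambda>xs. G (map (\<lambda>F. F xs) Fs))"
proof -
  obtain r where r: "\<And>ys. length ys = length Fs \<Longrightarrow> rec_eval r ys (G ys)"
    using assms(1) unfolding recursive_def by blast
  obtain s where s: "\<And>F xs. F \<in> set Fs \<Longrightarrow> length xs = k \<Longrightarrow> rec_eval (s F) xs (F xs)"
    using assms(2) unfolding recursive_def by metis
  have "rec_eval (Comp r (map s Fs)) xs (G (map (\<lambda>F. F xs) Fs))" if "length xs = k" for xs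
  proof (rule rec_eval.Comp)
    show "list_all2 (\<lambda>g y. rec_eval g xs y) (map s Fs) (map (\<lambda>F. F xs) Fs)"
      using s that by (auto simp: list_all2_conv_all_nth)
  qed (simp add: r)
  then show ?thesis unfolding recursive_def by blast
qed

lemma recursive_Suc: "recursive k F \<Longrightarrow> recursive k (\<lambda>xs. Suc (F xs))"
proof -
  assume F: "recursive k F"
  have "recursive (length [F]) (\<lambda>ys. Suc (hd ys))"
    unfolding recursive_def by (rule exI [of _ Succ]) (auto simp: length_Suc_conv intro: rec_eval.Succ)
  from recursive_compose [OF this, of k] F show ?thesis by simp
qed

lemma recursive_const: "recursive k (\<lambda>xs. c)"
proof (induction c)
  case 0
  show ?case unfolding recursive_def by (blast intro: rec_eval.Zero)
next
  case (Suc c)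
  then show ?case by (rule recursive_Suc)
qed

lemma recursive_apply:
  assumes "computable_fun f" and "recursive k F"
  shows "recursive k (\<lambda>xs. f (F xs))"
proof -
  have "recursive (length [F]) (\<lambda>ys. f (hd ys))"
    using assms(1) unfolding recursive_def computable_fun_def by (fastforce simp: length_Suc_conv)
  from recursive_compose [OF this, of k] assms(2) show ?thesis by simp
qed

text \<open>Appending all projections keeps the original arguments as parameters behind computed
  ones; this is how a computed counter is fed to \<open>PrimRec\<close>.\<close>

lemma recursive_append_args:
  assumes "recursive (length Fs + k) G" and "\<And>F. F \<in> set Fs \<Longrightarrow> recursive k F"
  shows "recursive k (\<lambda>xs. G (map (\<lambda>F. F xs) Fs @ xs))"
proof -
  let ?Ps = "map (\<lambda>i xs. xs ! i) [0..<k]"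
  have "recursive k (\<lambda>xs. G (map (\<lambda>F. F xs) (Fs @ ?Ps)))"
    by (rule recursive_compose) (use assms in \<open>auto intro: recursive_proj\<close>)
  then show ?thesis
    by (rule recursive_cong) (auto simp: comp_def map_nth)
qed

lemma recursive_weaken:
  assumes "recursive k F"
  shows "recursive (j + k) (\<lambda>xs. F (drop j xs))"
proof -
  let ?Ps = "map (\<lambda>i xs. xs ! (j + i)) [0..<k]"
  have "recursive (j + k) (\<lambda>xs. F (map (\<lambda>F. F xs) ?Ps))"
    by (rule recursive_compose) (use assms in \<open>auto intro: recursive_proj\<close>)
  then show ?thesis
    by (rule recursive_cong) (auto simp: comp_def intro!: arg_cong [of _ _ F] nth_equalityI)
qed

lemma recursive_rec_nat:
  assumes F: "recursive k F" and G: "recursive (2 + k) G" and N: "recursive k N"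
  shows "recursive k (\<lambda>xs. rec_nat (F xs) (\<lambda>n y. G (n # y # xs)) (N xs))"
proof -
  obtain r where r: "\<And>xs. length xs = k \<Longrightarrow> rec_eval r xs (F xs)"
    using F unfolding recursive_def by blast
  obtain s where s: "\<And>xs. length xs = 2 + k \<Longrightarrow> rec_eval s xs (G xs)"
    using G unfolding recursive_def by blast
  have *: "rec_eval (PrimRec r s) (n # xs) (rec_nat (F xs) (\<lambda>n y. G (n # y # xs)) n)"
    if "length xs = k" for n xs
  proof (induction n)
    case 0
    show ?case using r that by (auto intro: rec_eval.PrimRec_0)
  next
    case (Suc n)
    then show ?case using s that by (auto intro: rec_eval.PrimRec_Suc)
  qed
  have "recursive (length [N] + k)
      (\<lambda>ys. rec_nat (F (tl ys)) (\<lambda>n y. G (n # y # tl ys)) (hd ys))"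
    unfolding recursive_def by (rule exI [of _ "PrimRec r s"]) (auto simp: length_Suc_conv *)
  from recursive_append_args [OF this] N show ?thesis by simp
qed

text \<open>Assumption \<open>ex\<close> makes the search total, and below the least zero every
  value is a successor, as \<open>Mu\<close> demands.\<close>

lemma recursive_Least:
  assumes P: "recursive (Suc k) P" and ex: "\<And>xs. length xs = k \<Longrightarrow> \<exists>n. P (n # xs) = 0"
  shows "recursive k (\<lambda>xs. LEAST n. P (n # xs) = 0)"
proof -
  obtain r where r: "\<And>xs. length xs = Suc k \<Longrightarrow> rec_eval r xs (P xs)"
    using P unfolding recursive_def by blast
  have "rec_eval (Mu r) xs (LEAST n. P (n # xs) = 0)" if xs: "length xs = k" for xs
  proof (rule rec_eval.Mu)
    have "P ((LEAST n. P (n # xs) = 0) # xs) = 0"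
      using ex [OF xs] by (rule LeastI_ex)
    then show "rec_eval r ((LEAST n. P (n # xs) = 0) # xs) 0"
      using r [of "(LEAST n. P (n # xs) = 0) # xs"] xs by simp
    show "\<forall>m<LEAST n. P (n # xs) = 0. \<exists>y. rec_eval r (m # xs) (Suc y)"
    proof (intro allI impI)
      fix m assume "m < (LEAST n. P (n # xs) = 0)"
      then have "P (m # xs) \<noteq> 0" by (rule not_less_Least)
      then obtain y where "P (m # xs) = Suc y" using not0_implies_Suc by blast
      then show "\<exists>y. rec_eval r (m # xs) (Suc y)" using r [of "m # xs"] xs by auto
    qed
  qed
  then show ?thesis unfolding recursive_def by blast
qed

section \<open>Arithmetic and case distinction\<close>

lemma recursive_add:
  assumes "recursive k F" and "recursive k G"
  shows "recursive k (\<lambda>xs. F xs + G xs)"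
proof -
  have "recursive k (\<lambda>xs. rec_nat (F xs) (\<lambda>n y. Suc ((n # y # xs) ! 1)) (G xs))"
    by (intro recursive_rec_nat recursive_Suc recursive_proj assms) simp
  moreover have "rec_nat m (\<lambda>n y. Suc y) n = m + n" for m n :: nat
    by (induction n) auto
  ultimately show ?thesis by simp
qed

lemma recursive_diff:
  assumes "recursive k F" and "recursive k G"
  shows "recursive k (\<lambda>xs. F xs - G xs)"
proof -
  have pred: "recursive j (\<lambda>xs. H xs - 1)" if "recursive j H" for j H
  proof -
    have "recursive j (\<lambda>xs. rec_nat 0 (\<lambda>n y. (n # y # xs) ! 0) (H xs))"
      by (intro recursive_rec_nat recursive_const recursive_proj that) simp
    moreover have "rec_nat 0 (\<lambda>n y. n) n = n - 1" for n :: nat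
      by (cases n) auto
    ultimately show ?thesis by simp
  qed
  have "recursive k (\<lambda>xs. rec_nat (F xs) (\<lambda>n y. (n # y # xs) ! 1 - 1) (G xs))"
    by (intro recursive_rec_nat pred recursive_proj assms) simp
  moreover have "rec_nat m (\<lambda>n y. y - 1) n = m - n" for m n :: nat
    by (induction n) auto
  ultimately show ?thesis by simp
qed

lemma recursive_cmult: "recursive k F \<Longrightarrow> recursive k (\<lambda>xs. c * F xs)"
  by (induction c) (auto intro: recursive_add recursive_const)

text \<open>Case distinction is a recursion whose step discards counter and previous value
  (\<open>drop 2\<close>): any positive number of iterations returns \<open>G xs\<close>.\<close>

lemma recursive_if_zero:
  assumes "recursive k C" and "recursive k F" and "recursive k G"
  shows "recursive k (\<lambda>xs. if C xs = 0 then F xs else G xs)"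
proof -
  have "recursive k (\<lambda>xs. rec_nat (F xs) (\<lambda>n y. G (drop 2 (n # y # xs))) (C xs))"
    by (intro recursive_rec_nat recursive_weaken assms)
  moreover have "rec_nat u (\<lambda>n y. v) n = (if n = 0 then u else v)" for u v n :: nat
    by (cases n) auto
  ultimately show ?thesis by simp
qed

section \<open>Computable functions and sets of one argument\<close>

lemma recursive_computable_fun:
  assumes "recursive 1 (\<lambda>xs. f (xs ! 0))"
  shows "computable_fun f"
proof -
  obtain r where "\<And>xs. length xs = 1 \<Longrightarrow> rec_eval r xs (f (xs ! 0))"
    using assms unfolding recursive_def by blast
  from this [of "[x]" for x] show ?thesis unfolding computable_fun_def by auto
qed

lemma computable_fun_primrec:
  assumes h: "recursive 2 (\<lambda>xs. h (xs ! 0) (xs ! 1))" and f: "\<And>n. f (Suc n) = h n (f n)"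
  shows "computable_fun f"
proof (rule recursive_computable_fun)
  let ?G = "\<lambda>ys. h (ys ! 0) (ys ! 1)"
  \<comment> \<open>The step of the recursion receives counter, previous value and one parameter;
    the projections make \<open>h\<close> ignore the third.\<close>
  have "recursive 3 (\<lambda>ys. ?G (map (\<lambda>F. F ys) [\<lambda>ys. ys ! 0, \<lambda>ys. ys ! 1]))"
    by (rule recursive_compose) (use h in \<open>auto simp: numeral_2_eq_2 intro!: recursive_proj\<close>)
  then have "recursive (2 + 1) ?G" by simp
  from recursive_rec_nat [OF recursive_const this recursive_proj, of 0 "f 0"]
  have "recursive 1 (\<lambda>xs. rec_nat (f 0) h (xs ! 0))" by simp
  moreover have "rec_nat (f 0) h n = f n" for n
    by (induction n) (auto simp: f)
  ultimately show "recursive 1 (\<lambda>xs. f (xs ! 0))" by simp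
qed

lemma computable_set_Compl:
  assumes "computable_set A"
  shows "computable_set (- A)"
proof -
  have "recursive 1 (\<lambda>xs. if (if xs ! 0 \<in> A then 1 else 0 :: nat) = 0 then 1 else 0 :: nat)"
    using assms unfolding computable_set_def
    by (intro recursive_if_zero recursive_const recursive_apply [where f = "\<lambda>x. if x \<in> A then 1 else 0"]
        recursive_proj) auto
  then have "recursive 1 (\<lambda>xs. if xs ! 0 \<in> - A then 1 else 0 :: nat)"
    by (rule recursive_cong) simp
  then show ?thesis unfolding computable_set_def by (rule recursive_computable_fun)
qed

lemma computable_fun_if:
  assumes "computable_set A" and "computable_fun g" and "computable_fun h"
  shows "computable_fun (\<lambda>x. if x \<in> A then g x else h x)"
proof (rule recursive_computable_fun)
  have "recursive 1 (\<lambda>xs. if (if xs ! 0 \<in> A then 1 else 0 :: nat) = 0 then h (xs ! 0) else g (xs ! 0))"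
    using assms unfolding computable_set_def
    by (intro recursive_if_zero recursive_apply [where f = "\<lambda>x. if x \<in> A then 1 else 0"]
        recursive_apply [of g] recursive_apply [of h] recursive_proj) auto
  then show "recursive 1 (\<lambda>xs. if xs ! 0 \<in> A then g (xs ! 0) else h (xs ! 0))"
    by (rule recursive_cong) simp
qed

text \<open>Each element is reached from the previous one by an unbounded search, which halts
  because \<open>B\<close> is infinite.\<close>

lemma computable_fun_enumerate:
  assumes B: "computable_set B" and inf: "infinite B"
  shows "computable_fun (enumerate B)"
proof (rule computable_fun_primrec)
  let ?chi = "\<lambda>x. if x \<in> B then 1 else 0 :: nat"
  let ?next = "\<lambda>p. LEAST s. s \<in> B \<and> p < s"
  have ex: "\<exists>s. s \<in> B \<and> p < s" for p
    using inf infinite_nat_iff_unbounded by blast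
  \<comment> \<open>Truth is coded as zero: with truncated subtraction the first summand tests
    membership, the second tests \<open>p < s\<close>.\<close>
  have zero_iff: "(1 - ?chi s) + (Suc p - s) = 0 \<longleftrightarrow> s \<in> B \<and> p < s" for s p
    by auto
  \<comment> \<open>In \<open>s # xs\<close> the candidate stands at position 0, the recursion
    counter at 1 and the previous element at 2.\<close>
  have "recursive 2 (\<lambda>xs. LEAST s. (1 - ?chi ((s # xs) ! 0)) + (Suc ((s # xs) ! 2) - (s # xs) ! 0) = 0)"
  proof (rule recursive_Least)
    show "recursive (Suc 2) (\<lambda>ys. (1 - ?chi (ys ! 0)) + (Suc (ys ! 2) - ys ! 0))"
      using B unfolding computable_set_def
      by (intro recursive_add recursive_diff recursive_const recursive_Suc
          recursive_apply [where f = ?chi] recursive_proj) auto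
    show "\<exists>s. (1 - ?chi ((s # xs) ! 0)) + (Suc ((s # xs) ! 2) - (s # xs) ! 0) = 0" for xs
      unfolding zero_iff using ex by simp
  qed
  then show "recursive 2 (\<lambda>xs. ?next (xs ! 1))"
    by (simp only: zero_iff) simp
  show "enumerate B (Suc n) = ?next (enumerate B n)" for n
    by (rule enumerate_Suc'' [OF inf])
qed

subsection \<open>Negligible sets\<close>

text \<open>The additive constant absorbs all small \<open>n\<close>, so counts can be added and
  compared without division or limits.\<close>

lemma negligible_set_iff:
  "negligible_set S \<longleftrightarrow> (\<forall>e>0. \<exists>K. \<forall>n. real (card {k. k < n \<and> k \<in> S}) \<le> e * real n + K)"
proof
  assume S: "negligible_set S"
  show "\<forall>e>0. \<exists>K. \<forall>n. real (card {k. k < n \<and> k \<in> S}) \<le> e * real n + K"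
  proof (intro allI impI)
    fix e :: real assume e: "e > 0"
    then have "eventually (\<lambda>n. rho n S < e) sequentially"
      using S unfolding negligible_set_def has_density_def by (auto dest: order_tendstoD)
    then obtain M where M: "\<And>n. n \<ge> M \<Longrightarrow> rho n S < e"
      unfolding eventually_sequentially by blast
    have "real (card {k. k < n \<and> k \<in> S}) \<le> e * real n + real M" for n
    proof (cases "n \<ge> M \<and> n > 0")
      case True
      then have "real (card {k. k < n \<and> k \<in> S}) \<le> e * real n"
        using M [of n] unfolding rho_def by (simp add: field_simps)
      then show ?thesis by simp
    next
      case False
      have "card {k. k < n \<and> k \<in> S} \<le> card {..<n}" by (rule card_mono) auto
      then have "real (card {k. k < n \<and> k \<in> S}) \<le> real M" using False by auto
      moreover have "0 \<le> e * real n" using e by simp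
      ultimately show ?thesis by linarith
    qed
    then show "\<exists>K. \<forall>n. real (card {k. k < n \<and> k \<in> S}) \<le> e * real n + K" by blast
  qed
next
  assume bound: "\<forall>e>0. \<exists>K. \<forall>n. real (card {k. k < n \<and> k \<in> S}) \<le> e * real n + K"
  show "negligible_set S"
    unfolding negligible_set_def has_density_def
  proof (rule LIMSEQ_I)
    fix e :: real assume e: "0 < e"
    then obtain K where K: "\<And>n. real (card {k. k < n \<and> k \<in> S}) \<le> e / 2 * real n + K"
      using bound half_gt_zero by blast
    obtain M :: nat where M: "2 * K / e < real M" using reals_Archimedean2 by blast
    have "norm (rho n S - 0) < e" if "n \<ge> Suc M" for n
    proof -
      have "2 * K / e < real n" using M that by linarith
      then have "2 * K < e * real n" using e by (simp add: field_simps)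
      with K [of n] have "real (card {k. k < n \<and> k \<in> S}) < e * real n" by simp
      then show ?thesis using that unfolding rho_def by (simp add: field_simps)
    qed
    then show "\<exists>no. \<forall>n\<ge>no. norm (rho n S - 0) < e" by blast
  qed
qed

lemma negligible_set_subset:
  assumes "negligible_set T" and "S \<subseteq> T"
  shows "negligible_set S"
proof -
  have "real (card {k. k < n \<and> k \<in> S}) \<le> real (card {k. k < n \<and> k \<in> T})" for n
    by (intro of_nat_mono card_mono) (use assms(2) in auto)
  then show ?thesis using assms(1) unfolding negligible_set_iff by (meson order_trans)
qed

lemma negligible_set_Un:
  assumes "negligible_set S" and "negligible_set T"
  shows "negligible_set (S \<union> T)"
  unfolding negligible_set_iff
proof (intro allI impI)
  fix e :: real assume "e > 0"
  then obtain K L where K: "\<And>n. real (card {k. k < n \<and> k \<in> S}) \<le> e / 2 * real n + K"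
    and L: "\<And>n. real (card {k. k < n \<and> k \<in> T}) \<le> e / 2 * real n + L"
    using assms unfolding negligible_set_iff by (meson half_gt_zero)
  have "real (card {k. k < n \<and> k \<in> S \<union> T}) \<le> e * real n + (K + L)" for n
  proof -
    have "{k. k < n \<and> k \<in> S \<union> T} = {k. k < n \<and> k \<in> S} \<union> {k. k < n \<and> k \<in> T}" by auto
    then have "card {k. k < n \<and> k \<in> S \<union> T} \<le> card {k. k < n \<and> k \<in> S} + card {k. k < n \<and> k \<in> T}"
      by (simp add: card_Un_le)
    then have "real (card {k. k < n \<and> k \<in> S \<union> T})
        \<le> real (card {k. k < n \<and> k \<in> S}) + real (card {k. k < n \<and> k \<in> T})"
      by linarith
    with K [of n] L [of n] show ?thesis by simp
  qed
  then show "\<exists>K. \<forall>n. real (card {k. k < n \<and> k \<in> S \<union> T}) \<le> e * real n + K" by blast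
qed

lemma finite_negligible_set:
  assumes "finite S"
  shows "negligible_set S"
  unfolding negligible_set_iff
proof (intro allI impI exI)
  fix e :: real and n assume "e > 0"
  have "card {k. k < n \<and> k \<in> S} \<le> card S" by (rule card_mono) (use assms in auto)
  moreover have "0 \<le> e * real n" using \<open>e > 0\<close> by simp
  ultimately show "real (card {k. k < n \<and> k \<in> S}) \<le> e * real n + real (card S)" by linarith
qed

text \<open>Otherwise, for every \<open>q\<close>, all but a fixed finite number of the elements of
  \<open>B\<close> below \<open>n\<close> would have index at most \<open>n div Suc q\<close>, which
  forces density 0.\<close>

lemma not_negligible_enumerate_bound:
  assumes "\<not> negligible_set B"
  obtains q where "\<And>m. \<exists>d\<ge>m. enumerate B d \<le> q * d"
proof (rule ccontr)
  assume "\<not> thesis"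
  then have large: "\<exists>m. \<forall>d\<ge>m. q * d < enumerate B d" for q
    using that by (metis not_le)
  have inf: "infinite B" using assms finite_negligible_set by blast
  have "negligible_set B"
    unfolding negligible_set_iff
  proof (intro allI impI)
    fix e :: real assume e: "e > 0"
    obtain q :: nat where q: "inverse (Suc q) < e" using e reals_Archimedean by blast
    obtain m where m: "\<And>d. d \<ge> m \<Longrightarrow> Suc q * d < enumerate B d" using large by blast
    have "real (card {k. k < n \<and> k \<in> B}) \<le> e * real n + real (m + 1)" for n
    proof -
      have "{k. k < n \<and> k \<in> B} \<subseteq> enumerate B ` ({..<m} \<union> {..n div Suc q})"
      proof
        fix k assume k: "k \<in> {k. k < n \<and> k \<in> B}"
        then obtain d where d: "k = enumerate B d" using enumerate_Ex [of B k] inf by auto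
        have "d < m \<or> Suc q * d < n" using m [of d] d k by force
        then have "d < m \<or> d \<le> n div Suc q"
          by (metis less_imp_le less_eq_div_iff_mult_less_eq mult.commute zero_less_Suc)
        then show "k \<in> enumerate B ` ({..<m} \<union> {..n div Suc q})" using d by auto
      qed
      then have "card {k. k < n \<and> k \<in> B} \<le> card ({..<m} \<union> {..n div Suc q})"
        by (rule surj_card_le [rotated]) simp
      also have "\<dots> \<le> m + Suc (n div Suc q)"
        using card_Un_le [of "{..<m}" "{..n div Suc q}"] by simp
      finally have "real (card {k. k < n \<and> k \<in> B}) \<le> real m + 1 + real (n div Suc q)" by linarith
      also have "real (n div Suc q) \<le> real n / real (Suc q)" by (rule of_nat_div_le_of_nat)
      also have "\<dots> \<le> e * real n"
        using q mult_right_mono [of "inverse (Suc q)" e "real n"] by (simp add: divide_inverse mult.commute)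
      finally show ?thesis by simp
    qed
    then show "\<exists>K. \<forall>n. real (card {k. k < n \<and> k \<in> B}) \<le> e * real n + K" by blast
  qed
  with assms show False by contradiction
qed

subsection \<open>Restarting an enumeration\<close>

text \<open>Recursion on the time instead of a search makes computability immediate. The value 0 is
  also the default before a positive good number appears, so it need not be good.\<close>

fun last_good :: "(nat \<Rightarrow> nat) \<Rightarrow> nat \<Rightarrow> nat \<Rightarrow> nat" where
  "last_good b q 0 = 0"
| "last_good b q (Suc x) = (if b (Suc x) \<le> q * Suc x then Suc x else last_good b q x)"

text \<open>The limit is read afresh at each time: a run in progress is prolonged when a new good
  number appears.\<close>

fun walk :: "(nat \<Rightarrow> nat) \<Rightarrow> nat \<Rightarrow> nat \<Rightarrow> nat" where
  "walk b q 0 = 0"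
| "walk b q (Suc x) = (if walk b q x < last_good b q x then Suc (walk b q x) else 0)"

lemma computable_fun_last_good:
  assumes "computable_fun b"
  shows "computable_fun (last_good b q)"
proof (rule computable_fun_primrec)
  show "recursive 2 (\<lambda>xs. if b (Suc (xs ! 0)) - q * Suc (xs ! 0) = 0 then Suc (xs ! 0) else xs ! 1)"
    by (intro recursive_if_zero recursive_diff recursive_cmult recursive_Suc recursive_proj
        recursive_apply [OF assms]) auto
qed simp

lemma computable_fun_walk:
  assumes "computable_fun b"
  shows "computable_fun (walk b q)"
proof (rule computable_fun_primrec)
  show "recursive 2 (\<lambda>xs. if last_good b q (xs ! 0) - xs ! 1 = 0 then 0 else Suc (xs ! 1))"
    by (intro recursive_if_zero recursive_diff recursive_Suc recursive_proj recursive_const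
        recursive_apply [OF computable_fun_last_good [OF assms]]) auto
qed auto

lemma last_good_le: "last_good b q x \<le> x"
  by (induction x) auto

lemma last_good_mono: "x \<le> y \<Longrightarrow> last_good b q x \<le> last_good b q y"
proof (rule lift_Suc_mono_le [of "last_good b q"])
  show "last_good b q n \<le> last_good b q (Suc n)" for n
    using last_good_le [of b q n] by simp
qed

lemma last_good_good: "0 < last_good b q x \<Longrightarrow> b (last_good b q x) \<le> q * last_good b q x"
  by (induction x) (auto split: if_splits)

lemma last_good_eq: "b x \<le> q * x \<Longrightarrow> last_good b q x = x"
  by (cases x) auto

text \<open>The limit never decreases, and the index advances by one only when strictly below
  it.\<close>

lemma walk_le_last_good: "walk b q x \<le> last_good b q x"
proof (induction x)
  case (Suc x)
  then show ?case using last_good_mono [of x "Suc x" b q] by (auto simp del: last_good.simps)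
qed simp

lemma walk_le: "walk b q x \<le> x"
  using walk_le_last_good last_good_le by (rule order_trans)

lemma card_less_Suc_filter:
  "card {k. k < Suc n \<and> P k} = card {k. k < n \<and> P k} + (if P n then 1 else 0)"
proof -
  have "{k. k < Suc n \<and> P k} = (if P n then insert n {k. k < n \<and> P k} else {k. k < n \<and> P k})"
    by (auto simp: less_Suc_eq)
  then show ?thesis by simp
qed

lemma uniform_fun_walk:
  assumes b: "strict_mono b" and good: "\<And>m. \<exists>d\<ge>m. b d \<le> q * d"
  shows "uniform_fun (\<lambda>x. b (walk b q x))"
  unfolding uniform_fun_def
proof (intro allI impI)
  fix S assume S: "negligible_set S"
  let ?w = "walk b q" and ?d = "last_good b q"
  \<comment> \<open>\<open>N x\<close> counts the hits of \<open>S\<close> before time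
    \<open>x\<close>; \<open>T x\<close> counts those of a single run of \<open>x\<close>
    steps.\<close>
  define N where "N x = card {k. k < x \<and> b (?w k) \<in> S}" for x
  define T where "T x = card {k. k < x \<and> b k \<in> S}" for x
  have N_Suc: "N (Suc x) = N x + (if b (?w x) \<in> S then 1 else 0)" for x
    unfolding N_def by (rule card_less_Suc_filter)
  have T_Suc: "T (Suc x) = T x + (if b x \<in> S then 1 else 0)" for x
    unfolding T_def by (rule card_less_Suc_filter)
  show "negligible_set ((\<lambda>x. b (?w x)) -` S)"
    unfolding negligible_set_iff
  proof (intro allI impI)
    fix e :: real assume e: "e > 0"
    \<comment> \<open>One half of \<open>e\<close> pays for the completed runs, the other for the
      run in progress.\<close>
    define c where "c = e / 2"
    have c: "c > 0" using e unfolding c_def by simp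
    \<comment> \<open>Chosen so that \<open>a * (q + 1) = c / 2\<close>; the other
      \<open>c / 2\<close> absorbs \<open>K\<close> from \<open>M\<close> on.\<close>
    define a where "a = c / (2 * (real q + 1))"
    have "a > 0" using c unfolding a_def by simp
    then obtain K where K: "\<And>n. real (card {k. k < n \<and> k \<in> S}) \<le> a * real n + K"
      using S unfolding negligible_set_iff by blast
    obtain M :: nat where M: "2 * K / c < real M" using reals_Archimedean2 by blast
    have T_le: "real (T (Suc d)) \<le> c * real (Suc d)" if "d \<ge> M" "b d \<le> q * d" for d
    proof -
      \<comment> \<open>As \<open>b\<close> is increasing and \<open>b d \<le> q * d\<close>, the
        hits up to index \<open>d\<close> inject into the elements of \<open>S\<close> up to
        \<open>q * d\<close>.\<close>
      have "b ` {k. k < Suc d \<and> b k \<in> S} \<subseteq> {k. k < Suc (q * d) \<and> k \<in> S}"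
      proof (rule image_subsetI)
        fix k assume k: "k \<in> {k. k < Suc d \<and> b k \<in> S}"
        then have "b k \<le> b d" using strict_mono_less_eq [OF b] by simp
        then show "b k \<in> {k. k < Suc (q * d) \<and> k \<in> S}" using that(2) k by simp
      qed
      then have "card (b ` {k. k < Suc d \<and> b k \<in> S}) \<le> card {k. k < Suc (q * d) \<and> k \<in> S}"
        by (rule card_mono [rotated]) simp
      then have "T (Suc d) \<le> card {k. k < Suc (q * d) \<and> k \<in> S}"
        unfolding T_def using strict_mono_imp_inj_on [OF b]
        by (simp add: card_image inj_on_subset [OF _ subset_UNIV])
      then have "real (T (Suc d)) \<le> a * real (Suc (q * d)) + K"
        using K [of "Suc (q * d)"] by linarith
      also have "a * real (Suc (q * d)) \<le> a * ((real q + 1) * real (Suc d))"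
        using \<open>a > 0\<close> by (intro mult_left_mono) (auto simp: algebra_simps)
      also have "\<dots> = c / 2 * real (Suc d)"
        unfolding a_def by (simp add: field_simps)
      also have "K \<le> c / 2 * real (Suc d)"
      proof -
        have "2 * K / c < real (Suc d)" using M that(1) by linarith
        then show ?thesis using c by (simp add: field_simps)
      qed
      finally show ?thesis by simp
    qed
    \<comment> \<open>Since \<open>x0\<close> is good and positive, \<open>last_good\<close> is at
      least \<open>x0\<close> from then on, hence truly good and not the default 0.\<close>
    obtain x0 where x0: "x0 \<ge> Suc M" "b x0 \<le> q * x0" using good by blast
    have T_last: "real (T (Suc (?d x))) \<le> c * real (Suc (?d x))" if "x \<ge> x0" for x
    proof (rule T_le)
      have "x0 \<le> ?d x" using last_good_mono [OF that, of b q] last_good_eq [of b x0 q, OF x0(2)] by simp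
      then show "M \<le> ?d x" "b (?d x) \<le> q * ?d x" using x0 by (auto intro: last_good_good)
    qed
    \<comment> \<open>Completed runs meet \<open>S\<close> with frequency at most \<open>c\<close>; the current run has met it exactly
      \<open>T (?w x)\<close> times.\<close>
    have inv: "real (N x) \<le> c * real (x - ?w x) + real x0 + real (T (?w x))" if "x \<ge> x0" for x
      using that
    proof (induction x rule: dec_induct)
      case base
      have "N x0 \<le> card {..<x0}" unfolding N_def by (rule card_mono) auto
      moreover have "0 \<le> c * real (x0 - ?w x0)" using c by simp
      ultimately show ?case by simp
    next
      case (step x)
      show ?case
      proof (cases "?w x < ?d x")
        case True
        then show ?thesis using step.IH by (simp add: N_Suc T_Suc)
      next
        case False
        \<comment> \<open>The run ends here, at a good index, so its hits cost at most
          \<open>c\<close> times its \<open>Suc (?w x)\<close> steps; together with the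
          \<open>x - ?w x\<close> earlier steps these make up \<open>Suc x\<close>.\<close>
        then have w: "?w x = ?d x" using walk_le_last_good [of b q x] by simp
        have "real (N (Suc x)) \<le> c * real (x - ?w x) + real x0 + real (T (Suc (?w x)))"
          using step.IH by (simp add: N_Suc T_Suc)
        also have "\<dots> \<le> c * real (x - ?w x) + real x0 + c * real (Suc (?w x))"
          using T_last [OF step.hyps(1)] w by simp
        also have "\<dots> = c * real (Suc x) + real x0"
          using walk_le [of b q x] by (simp add: of_nat_diff algebra_simps)
        finally show ?thesis using False by simp
      qed
    qed
    have "real (N x) \<le> e * real x + (real x0 + c)" for x
    proof (cases "x \<ge> x0")
      case True
      \<comment> \<open>The current index need not be good, so the run in progress is compared with
        a run up to the last good number, which does not exceed \<open>x\<close>.\<close>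
      have "T (?w x) \<le> T (Suc (?d x))"
        unfolding T_def using walk_le_last_good [of b q x] by (intro card_mono) auto
      then have "real (T (?w x)) \<le> c * real (Suc (?d x))"
        using T_last [OF True] by linarith
      also have "\<dots> \<le> c * real (Suc x)"
        using c last_good_le [of b q x] by (intro mult_left_mono) auto
      finally have "real (T (?w x)) \<le> c * real (Suc x)" .
      moreover have "c * real (x - ?w x) \<le> c * real x"
        using c by (intro mult_left_mono) auto
      ultimately show ?thesis using inv [OF True] unfolding c_def by (simp add: algebra_simps)
    next
      case False
      have "N x \<le> card {..<x}" unfolding N_def by (rule card_mono) auto
      then have "real (N x) \<le> real x0" using False by simp
      moreover have "0 \<le> e * real x" using e by simp
      ultimately show ?thesis using c by linarith
    qed
    then show "\<exists>K. \<forall>n. real (card {k. k < n \<and> k \<in> (\<lambda>x. b (?w x)) -` S}) \<le> e * real n + K"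
      unfolding N_def vimage_eq by blast
  qed
qed

section \<open>Assembling the reduction\<close>

lemma computable_uniform_fun_into:
  assumes "computable_set B" and "\<not> negligible_set B"
  obtains g where "uniform_fun g" and "computable_fun g" and "\<And>x. g x \<in> B"
proof -
  have inf: "infinite B" using assms(2) finite_negligible_set by blast
  obtain q where q: "\<And>m. \<exists>d\<ge>m. enumerate B d \<le> q * d"
    using assms(2) by (rule not_negligible_enumerate_bound) blast
  let ?g = "\<lambda>x. enumerate B (walk (enumerate B) q x)"
  show thesis
  proof (rule that [of ?g])
    show "uniform_fun ?g"
      by (rule uniform_fun_walk [OF strict_mono_enumerate [OF inf] q])
    have e: "computable_fun (enumerate B)"
      by (rule computable_fun_enumerate [OF assms(1) inf])
    show "computable_fun ?g"
      by (intro recursive_computable_fun recursive_apply [OF e]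
          recursive_apply [OF computable_fun_walk [OF e]] recursive_proj) simp
    show "?g x \<in> B" for x by (rule enumerate_in_set [OF inf])
  qed
qed

text \<open>Whatever \<open>A\<close> is, the preimage of \<open>S\<close> lies in the union of its
  preimages under \<open>g\<close> and \<open>h\<close>.\<close>

lemma uniform_fun_if:
  assumes "uniform_fun g" and "uniform_fun h"
  shows "uniform_fun (\<lambda>x. if x \<in> A then g x else h x)"
  unfolding uniform_fun_def
proof (intro allI impI)
  fix S assume "negligible_set S"
  then have "negligible_set (g -` S \<union> h -` S)"
    using assms unfolding uniform_fun_def by (blast intro: negligible_set_Un)
  then show "negligible_set ((\<lambda>x. if x \<in> A then g x else h x) -` S)"
    by (rule negligible_set_subset) (auto split: if_splits)
qed

lemma computable_gm_reducible:
  assumes "computable_set A" and "computable_set B"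
    and "\<not> negligible_set B" and "\<not> negligible_set (- B)"
  shows "A \<le>\<^sub>g\<^sub>m B"
proof -
  obtain g where g: "uniform_fun g" "computable_fun g" "\<And>x. g x \<in> B"
    using computable_uniform_fun_into [OF assms(2,3)] by blast
  obtain h where h: "uniform_fun h" "computable_fun h" "\<And>x. h x \<in> - B"
    using computable_uniform_fun_into [OF computable_set_Compl [OF assms(2)] assms(4)] by blast
  have "x \<in> A \<longleftrightarrow> (if x \<in> A then g x else h x) \<in> B" for x
    using g(3) h(3) by auto
  then show ?thesis
    using uniform_fun_if [OF g(1) h(1)] computable_fun_if [OF assms(1) g(2) h(2)]
    unfolding gm_reducible_def by blast
qed

theorem theorem1:
  "(\<forall>A B :: nat set.
      computable_set A \<and> computable_set B \<and> \<not> negligible_set B \<and> \<not> negligible_set (- B)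
      \<longrightarrow> A \<le>\<^sub>g\<^sub>m B) \<and>
   (\<forall>A B :: nat set.
      computable_set A \<and> computable_set B \<and>
      \<not> negligible_set A \<and> \<not> negligible_set (- A) \<and> \<not> negligible_set B \<and> \<not> negligible_set (- B)
      \<longrightarrow> A \<le>\<^sub>g\<^sub>m B \<and> B \<le>\<^sub>g\<^sub>m A)"
  by (blast intro: computable_gm_reducible)

end
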